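(* Let $M$ be a monoid and let $A$ be a finite set with more than one element. Let $\mathrm{CA}(M,A)$ denote the monoid, under composition of maps, of all cellular automata $\tau \colon A^M \to A^M$ over the monoid $M$ and the alphabet $A$. Then the following conditions are equivalent: (a) the monoid $M$ is residually finite; (b) the monoid $\mathrm{CA}(M,A)$ is residually finite.
   Context: A monoid is a semigroup (a set with an associative binary operation) admitting an identity element; a monoid morphism is a map preserving products and sending the identity element to the identity element. A monoid $N$ is residually finite if for any two distinct elements $n_1, n_2 \in N$ there exist a finite monoid $F$ and a monoid morphism $\rho \colon N \to F$ such that $\rho(n_1) \neq \rho(n_2)$. For a monoid $M$ and a finite set $A$ (the alphabet), $A^M$ denotes the set of all maps $x \colon M \to A$ (configurations). It is equipped with the prodiscrete topology, i.e. the product topology on $A^M = \prod_{m \in M} A$ where each factor $A$ carries the discrete topology, and with the $M$-shift, i.e. the action of $M$ given by $(m,x) \mapsto mx$, where $(mx)(m') = x(m'm)$ for all $x \in A^M$ and $m, m' \in M$. A cellular automaton over $M$ and $A$ is a map $\tau \colon A^M \to A^M$ that is continuous for the prodiscrete topology and satisfies $\tau(mx) = m\tau(x)$ for all $m \in M$ and $x \in A^M$. *)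

theory Defs
  imports "HOL-Algebra.Group" "HOL-Analysis.Function_Topology"
begin

section \<open>Residually finite monoids\<close>

definition monoid_hom :: "('m, 'b) monoid_scheme \<Rightarrow> ('n, 'c) monoid_scheme \<Rightarrow> ('m \<Rightarrow> 'n) set" where
  "monoid_hom M N = {h \<in> hom M N. h \<one>\<^bsub>M\<^esub> = \<one>\<^bsub>N\<^esub>}"

text \<open>
  HOL cannot quantify over types inside a formula, so the finite monoids are taken with carrier a
  finite set of natural numbers. Every finite monoid is isomorphic to one of this form; the lemma
  \<open>residually_finite_iff\<close> below shows that any other infinite carrier type gives the same notion,
  and \<open>residually_finiteI\<close> that finite target monoids of arbitrary type suffice.
\<close>

definition residually_finite :: "('n, 'b) monoid_scheme \<Rightarrow> bool" where
  "residually_finite N \<longleftrightarrow>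
    (\<forall>n1 \<in> carrier N. \<forall>n2 \<in> carrier N. n1 \<noteq> n2 \<longrightarrow>
      (\<exists>(F :: nat monoid) \<rho>.
        monoid F \<and> finite (carrier F) \<and> \<rho> \<in> monoid_hom N F \<and> \<rho> n1 \<noteq> \<rho> n2))"

lemma transfer_finite_monoid:
  fixes N :: "('n, 'b) monoid_scheme" and F :: "('f, 'c) monoid_scheme"
  assumes F: "monoid F" "finite (carrier F)" and \<rho>: "\<rho> \<in> monoid_hom N F"
    and n: "n1 \<in> carrier N" "n2 \<in> carrier N" "\<rho> n1 \<noteq> \<rho> n2"
    and inf: "infinite (UNIV :: 'g set)"
  shows "\<exists>(G :: 'g monoid) \<sigma>.
    monoid G \<and> finite (carrier G) \<and> \<sigma> \<in> monoid_hom N G \<and> \<sigma> n1 \<noteq> \<sigma> n2"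
proof -
  interpret F: monoid F by (fact F(1))
  obtain B :: "'g set" where B: "finite B" "card B = card (carrier F)"
    using infinite_arbitrarily_large[OF inf] by blast
  obtain f where f: "bij_betw f (carrier F) B"
    using finite_same_card_bij[OF F(2) B(1)] B(2) by auto
  define g where "g = inv_into (carrier F) f"
  have gf [simp]: "g (f x) = x" if "x \<in> carrier F" for x
    using f that by (auto simp: g_def bij_betw_def)
  have fg [simp]: "f (g y) = y" and gB [simp]: "g y \<in> carrier F" if "y \<in> B" for y
    using f that by (auto simp: g_def bij_betw_def f_inv_into_f inv_into_into)
  have fB [simp]: "f x \<in> B" if "x \<in> carrier F" for x
    using f that by (auto simp: bij_betw_def)
  define G :: "'g monoid" where
    "G = \<lparr>carrier = B, mult = (\<lambda>x y. f (g x \<otimes>\<^bsub>F\<^esub> g y)), one = f \<one>\<^bsub>F\<^esub>\<rparr>"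
  have "monoid G"
    by (rule monoidI) (auto simp: G_def F.m_assoc)
  moreover have "f \<circ> \<rho> \<in> monoid_hom N G"
    using \<rho> by (auto simp: monoid_hom_def hom_def G_def Pi_iff)
  moreover have "(f \<circ> \<rho>) n1 \<noteq> (f \<circ> \<rho>) n2"
  proof -
    have "\<rho> n1 \<in> carrier F" "\<rho> n2 \<in> carrier F"
      using \<rho> n by (auto simp: monoid_hom_def hom_def)
    then show ?thesis using n(3) by (metis gf comp_apply)
  qed
  moreover have "finite (carrier G)" using B by (simp add: G_def)
  ultimately show ?thesis by blast
qed

lemma residually_finite_iff:
  fixes N :: "('n, 'b) monoid_scheme"
  assumes "infinite (UNIV :: 'f set)"
  shows "residually_finite N \<longleftrightarrow>
    (\<forall>n1 \<in> carrier N. \<forall>n2 \<in> carrier N. n1 \<noteq> n2 \<longrightarrow>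
      (\<exists>(F :: 'f monoid) \<rho>.
        monoid F \<and> finite (carrier F) \<and> \<rho> \<in> monoid_hom N F \<and> \<rho> n1 \<noteq> \<rho> n2))"
proof -
  have "(\<exists>(F :: nat monoid) \<rho>.
          monoid F \<and> finite (carrier F) \<and> \<rho> \<in> monoid_hom N F \<and> \<rho> n1 \<noteq> \<rho> n2) \<longleftrightarrow>
        (\<exists>(F :: 'f monoid) \<rho>.
          monoid F \<and> finite (carrier F) \<and> \<rho> \<in> monoid_hom N F \<and> \<rho> n1 \<noteq> \<rho> n2)"
    (is "?L \<longleftrightarrow> ?R") if n: "n1 \<in> carrier N" "n2 \<in> carrier N" for n1 n2
  proof
    assume ?L
    then obtain F :: "nat monoid" and \<rho> where
      "monoid F" "finite (carrier F)" "\<rho> \<in> monoid_hom N F" "\<rho> n1 \<noteq> \<rho> n2" by (elim exE conjE)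
    from transfer_finite_monoid[OF this(1-3) n this(4) assms] show ?R .
  next
    assume ?R
    then obtain F :: "'f monoid" and \<rho> where
      "monoid F" "finite (carrier F)" "\<rho> \<in> monoid_hom N F" "\<rho> n1 \<noteq> \<rho> n2" by (elim exE conjE)
    from transfer_finite_monoid[OF this(1-3) n this(4) infinite_UNIV_nat] show ?L .
  qed
  then show ?thesis by (simp add: residually_finite_def cong: ball_cong)
qed

lemma residually_finiteI:
  fixes N :: "('n, 'b) monoid_scheme"
  assumes "\<And>n1 n2. n1 \<in> carrier N \<Longrightarrow> n2 \<in> carrier N \<Longrightarrow> n1 \<noteq> n2 \<Longrightarrow>
    \<exists>(F :: ('f, 'c) monoid_scheme) \<rho>.
      monoid F \<and> finite (carrier F) \<and> \<rho> \<in> monoid_hom N F \<and> \<rho> n1 \<noteq> \<rho> n2"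
  shows "residually_finite N"
  unfolding residually_finite_def
proof (intro ballI impI)
  fix n1 n2 assume n: "n1 \<in> carrier N" "n2 \<in> carrier N" "n1 \<noteq> n2"
  obtain F :: "('f, 'c) monoid_scheme" and \<rho> where
    "monoid F" "finite (carrier F)" "\<rho> \<in> monoid_hom N F" "\<rho> n1 \<noteq> \<rho> n2"
    using assms[OF n] by (elim exE conjE)
  from transfer_finite_monoid[OF this(1-3) n(1,2) this(4) infinite_UNIV_nat]
  show "\<exists>(F :: nat monoid) \<rho>.
    monoid F \<and> finite (carrier F) \<and> \<rho> \<in> monoid_hom N F \<and> \<rho> n1 \<noteq> \<rho> n2" .
qed

section \<open>Cellular automata over a monoid\<close>

text \<open>
  Maps with domain a set \<open>S\<close> are represented by functions that are \<open>undefined\<close> outside \<open>S\<close>, so that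
  equality of representatives is equality of maps.
\<close>

definition configurations :: "('m, 'b) monoid_scheme \<Rightarrow> 'a set \<Rightarrow> ('m \<Rightarrow> 'a) set" where
  "configurations M A = carrier M \<rightarrow>\<^sub>E A"

definition prodiscrete :: "('m, 'b) monoid_scheme \<Rightarrow> 'a set \<Rightarrow> ('m \<Rightarrow> 'a) topology" where
  "prodiscrete M A = product_topology (\<lambda>_. discrete_topology A) (carrier M)"

definition shift :: "('m, 'b) monoid_scheme \<Rightarrow> 'm \<Rightarrow> ('m \<Rightarrow> 'a) \<Rightarrow> ('m \<Rightarrow> 'a)" where
  "shift M m x = (\<lambda>m' \<in> carrier M. x (m' \<otimes>\<^bsub>M\<^esub> m))"

definition cellular_automata ::
    "('m, 'b) monoid_scheme \<Rightarrow> 'a set \<Rightarrow> (('m \<Rightarrow> 'a) \<Rightarrow> ('m \<Rightarrow> 'a)) set" where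
  "cellular_automata M A =
    {\<tau> \<in> configurations M A \<rightarrow>\<^sub>E configurations M A.
      continuous_map (prodiscrete M A) (prodiscrete M A) \<tau> \<and>
      (\<forall>m \<in> carrier M. \<forall>x \<in> configurations M A. \<tau> (shift M m x) = shift M m (\<tau> x))}"

definition CA :: "('m, 'b) monoid_scheme \<Rightarrow> 'a set \<Rightarrow> (('m \<Rightarrow> 'a) \<Rightarrow> ('m \<Rightarrow> 'a)) monoid" where
  "CA M A =
    \<lparr>carrier = cellular_automata M A,
     mult = (\<lambda>\<tau> \<sigma>. compose (configurations M A) \<tau> \<sigma>),
     one = (\<lambda>x \<in> configurations M A. x)\<rparr>"

lemma topspace_prodiscrete: "topspace (prodiscrete M A) = configurations M A"
  by (simp add: prodiscrete_def configurations_def)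

lemma shift_in_configurations:
  assumes "monoid M" "m \<in> carrier M" "x \<in> configurations M A"
  shows "shift M m x \<in> configurations M A"
  using assms by (auto simp: shift_def configurations_def monoid.m_closed)

lemma shift_mult:
  assumes "monoid M" "m \<in> carrier M" "n \<in> carrier M"
  shows "shift M (m \<otimes>\<^bsub>M\<^esub> n) x = shift M m (shift M n x)"
  using assms by (auto simp: shift_def fun_eq_iff monoid.m_closed monoid.m_assoc)

lemma shift_one:
  assumes "monoid M" "x \<in> configurations M A"
  shows "shift M \<one>\<^bsub>M\<^esub> x = x"
proof
  fix m
  show "shift M \<one>\<^bsub>M\<^esub> x m = x m"
    using assms(1) PiE_arb[of x "carrier M" "\<lambda>_. A" m] assms(2)
    by (cases "m \<in> carrier M") (simp_all add: shift_def configurations_def monoid.r_one)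
qed

lemma monoid_CA:
  assumes M: "monoid M"
  shows "monoid (CA M A)"
proof (rule monoidI)
  let ?C = "configurations M A" and ?T = "prodiscrete M A"
  fix \<tau> \<sigma> assume "\<tau> \<in> carrier (CA M A)" "\<sigma> \<in> carrier (CA M A)"
  then have \<tau>: "\<tau> \<in> ?C \<rightarrow>\<^sub>E ?C" "continuous_map ?T ?T \<tau>"
      "\<And>m x. m \<in> carrier M \<Longrightarrow> x \<in> ?C \<Longrightarrow> \<tau> (shift M m x) = shift M m (\<tau> x)"
    and \<sigma>: "\<sigma> \<in> ?C \<rightarrow>\<^sub>E ?C" "continuous_map ?T ?T \<sigma>"
      "\<And>m x. m \<in> carrier M \<Longrightarrow> x \<in> ?C \<Longrightarrow> \<sigma> (shift M m x) = shift M m (\<sigma> x)"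
    by (auto simp: CA_def cellular_automata_def)
  have "continuous_map ?T ?T (compose ?C \<tau> \<sigma>)"
    by (rule continuous_map_eq[OF continuous_map_compose[OF \<sigma>(2) \<tau>(2)]])
      (simp add: topspace_prodiscrete compose_def)
  moreover have "compose ?C \<tau> \<sigma> \<in> ?C \<rightarrow>\<^sub>E ?C"
    using \<tau>(1) \<sigma>(1) by (auto simp: compose_def)
  moreover have "compose ?C \<tau> \<sigma> (shift M m x) = shift M m (compose ?C \<tau> \<sigma> x)"
    if "m \<in> carrier M" "x \<in> ?C" for m x
    using that \<tau>(3) \<sigma>(3) shift_in_configurations[OF M that] PiE_mem[OF \<sigma>(1) that(2)]
    by (simp add: compose_def)
  ultimately show "\<tau> \<otimes>\<^bsub>CA M A\<^esub> \<sigma> \<in> carrier (CA M A)"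
    by (simp add: CA_def cellular_automata_def)
next
  let ?C = "configurations M A" and ?T = "prodiscrete M A"
  have "continuous_map ?T ?T (\<lambda>x \<in> ?C. x)"
    by (rule continuous_map_eq[OF continuous_map_id]) (simp add: topspace_prodiscrete)
  then show "\<one>\<^bsub>CA M A\<^esub> \<in> carrier (CA M A)"
    by (auto simp: CA_def cellular_automata_def shift_in_configurations[OF M])
next
  fix \<tau> \<sigma> \<upsilon> assume "\<tau> \<in> carrier (CA M A)" "\<sigma> \<in> carrier (CA M A)" "\<upsilon> \<in> carrier (CA M A)"
  then have "\<upsilon> \<in> configurations M A \<rightarrow> configurations M A"
    by (simp add: CA_def cellular_automata_def PiE_def)
  from compose_assoc[OF this, symmetric]
  show "\<tau> \<otimes>\<^bsub>CA M A\<^esub> \<sigma> \<otimes>\<^bsub>CA M A\<^esub> \<upsilon> = \<tau> \<otimes>\<^bsub>CA M A\<^esub> (\<sigma> \<otimes>\<^bsub>CA M A\<^esub> \<upsilon>)"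
    by (simp add: CA_def)
next
  fix \<tau> assume "\<tau> \<in> carrier (CA M A)"
  then have \<tau>: "\<tau> \<in> configurations M A \<rightarrow> configurations M A" "\<tau> \<in> extensional (configurations M A)"
    by (simp_all add: CA_def cellular_automata_def PiE_def)
  show "\<one>\<^bsub>CA M A\<^esub> \<otimes>\<^bsub>CA M A\<^esub> \<tau> = \<tau>" "\<tau> \<otimes>\<^bsub>CA M A\<^esub> \<one>\<^bsub>CA M A\<^esub> = \<tau>"
    using Id_compose[OF \<tau>] compose_Id[OF \<tau>] by (simp_all add: CA_def)
qed

end

theory Submission
  imports Defs
begin

text \<open>
  One direction is an embedding. Left translation of the argument, \<open>x \<mapsto> (m' \<mapsto> x (m m'))\<close>, commutes
  with all shifts, because these translate on the right; it reverses products, and as soon as \<open>A\<close>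
  has two elements it determines \<open>m\<close>. So the opposite monoid of \<open>M\<close> embeds into \<open>CA(M, A)\<close>
  (lemma \<open>translation_hom\<close>), and residual finiteness passes to submonoids and to opposite monoids.

  For the other direction, a finite quotient \<open>\<rho>\<close> of \<open>M\<close> yields a finite set of configurations, those
  that factor through \<open>\<rho>\<close>. Such configurations can be described by shifts alone (lemma
  \<open>factoring_iff_shift\<close>), hence cellular automata preserve them, and \<open>CA(M, A)\<close> acts on a finite
  set. Two distinct cellular automata \<open>\<tau>\<close> and \<open>\<sigma>\<close> differ at the identity element on some
  configuration \<open>x\<close>, and by continuity this only concerns the values of \<open>x\<close> on a finite set \<open>S\<close>.
  If \<open>M\<close> is residually finite, then \<open>\<rho>\<close> can be chosen injective on \<open>S\<close>; some configuration that
  factors through \<open>\<rho>\<close> then agrees with \<open>x\<close> on \<open>S\<close>, so \<open>\<tau>\<close> and \<open>\<sigma>\<close> already differ on the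
  finite set.
\<close>

section \<open>Permanence properties of residual finiteness\<close>

lemma residually_finite_of_inj_hom:
  assumes "h \<in> monoid_hom M N" "inj_on h (carrier M)" "residually_finite N"
  shows "residually_finite M"
  unfolding residually_finite_def
proof (intro ballI impI)
  fix a b assume ab: "a \<in> carrier M" "b \<in> carrier M" "a \<noteq> b"
  then have "h a \<in> carrier N" "h b \<in> carrier N" "h a \<noteq> h b"
    using assms(1,2) by (auto simp: monoid_hom_def hom_def inj_on_def)
  then obtain F :: "nat monoid" and \<rho> where
    F: "monoid F" "finite (carrier F)" "\<rho> \<in> monoid_hom N F" "\<rho> (h a) \<noteq> \<rho> (h b)"
    using assms(3) unfolding residually_finite_def by meson
  moreover have "\<rho> \<circ> h \<in> monoid_hom M F"
    using assms(1) F(3) by (auto simp: monoid_hom_def hom_def Pi_iff)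
  ultimately show "\<exists>(F :: nat monoid) \<rho>.
      monoid F \<and> finite (carrier F) \<and> \<rho> \<in> monoid_hom M F \<and> \<rho> a \<noteq> \<rho> b"
    by (metis comp_apply)
qed

definition opposite :: "('m, 'b) monoid_scheme \<Rightarrow> 'm monoid" where
  "opposite M = \<lparr>carrier = carrier M, mult = (\<lambda>x y. y \<otimes>\<^bsub>M\<^esub> x), one = \<one>\<^bsub>M\<^esub>\<rparr>"

lemma monoid_opposite:
  assumes "monoid M"
  shows "monoid (opposite M)"
proof -
  interpret monoid M by (fact assms)
  show ?thesis by (rule monoidI) (auto simp: opposite_def m_assoc)
qed

lemma residually_finite_of_opposite:
  assumes M: "residually_finite (opposite M)"
  shows "residually_finite M"
  unfolding residually_finite_def
proof (intro ballI impI)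
  fix a b assume ab: "a \<in> carrier M" "b \<in> carrier M" "a \<noteq> b"
  have "carrier (opposite M) = carrier M" by (simp add: opposite_def)
  with ab obtain F :: "nat monoid" and \<rho> where
    F: "monoid F" "finite (carrier F)" "\<rho> \<in> monoid_hom (opposite M) F" "\<rho> a \<noteq> \<rho> b"
    using M unfolding residually_finite_def by metis
  have "\<rho> \<in> monoid_hom M (opposite F)"
    using F(3) by (auto simp: monoid_hom_def hom_def opposite_def)
  moreover have "finite (carrier (opposite F))"
    using F(2) by (simp add: opposite_def)
  ultimately show "\<exists>(F :: nat monoid) \<rho>.
      monoid F \<and> finite (carrier F) \<and> \<rho> \<in> monoid_hom M F \<and> \<rho> a \<noteq> \<rho> b"
    using monoid_opposite[OF F(1)] F(4) by blast
qed

text \<open>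
  The fibres of such a map are the classes of a left congruence of \<open>M\<close>. Every homomorphism is left
  compatible; a product of homomorphisms is too, whatever type its values have.
\<close>

definition left_compatible :: "('m, 'b) monoid_scheme \<Rightarrow> ('m \<Rightarrow> 'c) \<Rightarrow> bool" where
  "left_compatible M \<rho> \<longleftrightarrow> (\<forall>k \<in> carrier M. \<forall>m \<in> carrier M. \<forall>n \<in> carrier M.
    \<rho> m = \<rho> n \<longrightarrow> \<rho> (k \<otimes>\<^bsub>M\<^esub> m) = \<rho> (k \<otimes>\<^bsub>M\<^esub> n))"

text \<open>
  The map \<open>\<rho>\<close> is the product of homomorphisms to finite monoids, one for each pair of distinct
  elements of \<open>S\<close>.
\<close>

lemma residually_finite_separates_finite_set:
  assumes M: "monoid M" "residually_finite M" and S: "finite S" "S \<subseteq> carrier M"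
  obtains \<rho> :: "'m \<Rightarrow> 'm \<times> 'm \<Rightarrow> nat"
  where "finite (\<rho> ` carrier (M :: ('m, 'b) monoid_scheme))" "inj_on \<rho> S"
    "left_compatible M \<rho>"
proof -
  interpret monoid M by (fact M(1))
  define P where "P = {(s, t). s \<in> S \<and> t \<in> S \<and> s \<noteq> t}"
  have "finite P"
    by (rule finite_subset[of _ "S \<times> S"]) (auto simp: P_def S(1))
  have "\<exists>F \<rho>. monoid F \<and> finite (carrier F) \<and> \<rho> \<in> monoid_hom M (F :: nat monoid) \<and>
      \<rho> (fst p) \<noteq> \<rho> (snd p)" if "p \<in> P" for p
  proof -
    have "fst p \<in> carrier M" "snd p \<in> carrier M" "fst p \<noteq> snd p"
      using S(2) that by (auto simp: P_def)
    then show ?thesis using M(2) unfolding residually_finite_def by blast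
  qed
  then obtain F :: "'m \<times> 'm \<Rightarrow> nat monoid" and r where
    F: "\<And>p. p \<in> P \<Longrightarrow> finite (carrier (F p))"
       "\<And>p. p \<in> P \<Longrightarrow> r p \<in> monoid_hom M (F p)"
       "\<And>p. p \<in> P \<Longrightarrow> r p (fst p) \<noteq> r p (snd p)"
    by metis
  define \<rho> where "\<rho> m = (\<lambda>p \<in> P. r p m)" for m
  have r_mult: "r p (k \<otimes>\<^bsub>M\<^esub> m) = r p k \<otimes>\<^bsub>F p\<^esub> r p m"
    if "p \<in> P" "k \<in> carrier M" "m \<in> carrier M" for p k m
    using F(2)[OF that(1)] that by (auto simp: monoid_hom_def hom_def)
  have \<rho>_eqD: "r p m = r p n" if "\<rho> m = \<rho> n" "p \<in> P" for m n p
    using fun_cong[OF that(1), of p] that(2) by (simp add: \<rho>_def)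
  show thesis
  proof
    have "\<rho> ` carrier M \<subseteq> Pi\<^sub>E P (\<lambda>p. carrier (F p))"
      using F(2) by (fastforce simp: \<rho>_def monoid_hom_def hom_def)
    then show "finite (\<rho> ` carrier M)"
      by (rule finite_subset) (simp add: finite_PiE \<open>finite P\<close> F(1))
    show "inj_on \<rho> S"
    proof (rule inj_onI, rule ccontr)
      fix s t assume "s \<in> S" "t \<in> S" "\<rho> s = \<rho> t" "s \<noteq> t"
      then have "(s, t) \<in> P" by (simp add: P_def)
      from F(3)[OF this] \<rho>_eqD[OF \<open>\<rho> s = \<rho> t\<close> this] show False by simp
    qed
    have "\<rho> (k \<otimes>\<^bsub>M\<^esub> m) = \<rho> (k \<otimes>\<^bsub>M\<^esub> n)"
      if "k \<in> carrier M" "m \<in> carrier M" "n \<in> carrier M" "\<rho> m = \<rho> n" for k m n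
      using that \<rho>_eqD[OF that(4)] by (auto simp: \<rho>_def r_mult restrict_def fun_eq_iff)
    then show "left_compatible M \<rho>" unfolding left_compatible_def by blast
  qed
qed

section \<open>The embedding of the opposite monoid into the cellular automata\<close>

text \<open>
  The group-theoretic analogue is the left regular representation: it commutes with the right one,
  which is the shift.
\<close>

definition translation ::
    "('m, 'b) monoid_scheme \<Rightarrow> 'a set \<Rightarrow> 'm \<Rightarrow> ('m \<Rightarrow> 'a) \<Rightarrow> ('m \<Rightarrow> 'a)" where
  "translation M A m = (\<lambda>x \<in> configurations M A. \<lambda>m' \<in> carrier M. x (m \<otimes>\<^bsub>M\<^esub> m'))"

lemma translation_in_configurations:
  assumes "monoid M" "m \<in> carrier M" "x \<in> configurations M A"
  shows "translation M A m x \<in> configurations M A"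
  using assms by (auto simp: translation_def configurations_def monoid.m_closed)

lemma translation_cellular_automaton:
  assumes M: "monoid M" and m: "m \<in> carrier M"
  shows "translation M A m \<in> cellular_automata M A"
proof -
  interpret monoid M by (fact M)
  let ?T = "prodiscrete M A"
  have "continuous_map ?T (discrete_topology A) (\<lambda>x. translation M A m x k)"
    if k: "k \<in> carrier M" for k
  proof (rule continuous_map_eq)
    show "continuous_map ?T (discrete_topology A) (\<lambda>x. x (m \<otimes>\<^bsub>M\<^esub> k))"
      unfolding prodiscrete_def
      by (rule continuous_map_product_projection) (simp add: m k)
    show "x (m \<otimes>\<^bsub>M\<^esub> k) = translation M A m x k" if "x \<in> topspace ?T" for x
      using that k by (simp add: topspace_prodiscrete translation_def)
  qed
  moreover have "translation M A m ` topspace ?T \<subseteq> extensional (carrier M)"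
    by (auto simp: topspace_prodiscrete translation_def)
  ultimately have "continuous_map ?T ?T (translation M A m)"
    unfolding prodiscrete_def by (simp add: continuous_map_componentwise)
  moreover have "translation M A m (shift M n x) = shift M n (translation M A m x)"
    if n: "n \<in> carrier M" and x: "x \<in> configurations M A" for n x
    using shift_in_configurations[OF M n x] m n x
    by (auto simp: translation_def shift_def m_assoc fun_eq_iff)
  moreover have "translation M A m \<in> configurations M A \<rightarrow>\<^sub>E configurations M A"
    using translation_in_configurations[OF M m, of _ A]
    by (simp add: PiE_iff) (simp add: translation_def)
  ultimately show ?thesis by (simp add: cellular_automata_def)
qed

lemma translation_hom:
  assumes M: "monoid M"
  shows "translation M A \<in> monoid_hom (opposite M) (CA M A)"
proof -
  interpret monoid M by (fact M)
  have "translation M A (n \<otimes>\<^bsub>M\<^esub> m) =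
      compose (configurations M A) (translation M A m) (translation M A n)"
    if mn: "m \<in> carrier M" "n \<in> carrier M" for m n
  proof
    fix x
    show "translation M A (n \<otimes>\<^bsub>M\<^esub> m) x =
      compose (configurations M A) (translation M A m) (translation M A n) x"
      using translation_in_configurations[OF M mn(2), of x A] mn
      by (cases "x \<in> configurations M A")
        (auto simp: compose_def translation_def m_assoc fun_eq_iff)
  qed
  moreover have "translation M A \<one>\<^bsub>M\<^esub> = (\<lambda>x \<in> configurations M A. x)"
  proof
    fix x
    have "(\<lambda>k \<in> carrier M. x (\<one>\<^bsub>M\<^esub> \<otimes>\<^bsub>M\<^esub> k)) = x" if "x \<in> configurations M A"
      using PiE_arb[OF that[unfolded configurations_def]] by (simp add: restrict_def fun_eq_iff)
    then show "translation M A \<one>\<^bsub>M\<^esub> x = (\<lambda>x \<in> configurations M A. x) x"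
      by (simp add: translation_def)
  qed
  ultimately show ?thesis
    using translation_cellular_automaton[OF M]
    by (auto simp: monoid_hom_def hom_def CA_def opposite_def)
qed

text \<open>
  The translation by \<open>m\<close> sends \<open>x\<close> to a configuration with value \<open>x m\<close> at the identity element, and
  a configuration can take two distinct letters at two distinct elements.
\<close>

lemma inj_on_translation:
  assumes M: "monoid M" and ab: "a \<in> A" "b \<in> A" "a \<noteq> b"
  shows "inj_on (translation M A) (carrier M)"
proof (rule inj_onI, rule ccontr)
  interpret monoid M by (fact M)
  fix m n assume mn: "m \<in> carrier M" "n \<in> carrier M" "m \<noteq> n"
    and eq: "translation M A m = translation M A n"
  define x where "x = (\<lambda>k \<in> carrier M. if k = m then a else b)"
  have x: "x \<in> configurations M A"
    using ab by (auto simp: x_def configurations_def)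
  have "translation M A m x \<one>\<^bsub>M\<^esub> = translation M A n x \<one>\<^bsub>M\<^esub>"
    using eq by simp
  then show False
    using x mn ab by (simp add: translation_def) (simp add: x_def)
qed

section \<open>Locality of cellular automata\<close>

lemma prodiscrete_continuous_local:
  assumes \<tau>: "continuous_map (prodiscrete M A) (prodiscrete M A) \<tau>"
    and x: "x \<in> configurations M A" and m: "m \<in> carrier M"
  obtains S where "finite S" "S \<subseteq> carrier M"
    "\<And>y. y \<in> configurations M A \<Longrightarrow> \<forall>s \<in> S. y s = x s \<Longrightarrow> \<tau> y m = \<tau> x m"
proof -
  have cont: "continuous_map (prodiscrete M A) (discrete_topology A) (\<lambda>y. \<tau> y m)"
    using \<tau> m unfolding prodiscrete_def by (simp add: continuous_map_componentwise)
  have "\<tau> x m \<in> A"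
    using continuous_map_funspace[OF cont] x by (auto simp: topspace_prodiscrete)
  then have "openin (prodiscrete M A) {y \<in> configurations M A. \<tau> y m \<in> {\<tau> x m}}"
    using openin_continuous_map_preimage[OF cont, of "{\<tau> x m}"] by (simp add: topspace_prodiscrete)
  then obtain U where U: "finite {i \<in> carrier M. U i \<noteq> A}" "x \<in> Pi\<^sub>E (carrier M) U"
      "Pi\<^sub>E (carrier M) U \<subseteq> {y \<in> configurations M A. \<tau> y m \<in> {\<tau> x m}}"
    using x unfolding prodiscrete_def openin_product_topology_alt by (auto 0 3)
  show thesis
  proof
    fix y assume y: "y \<in> configurations M A" "\<forall>s \<in> {i \<in> carrier M. U i \<noteq> A}. y s = x s"
    have "y i \<in> U i" if "i \<in> carrier M" for i
      using y that U(2) by (cases "U i = A") (auto simp: configurations_def PiE_iff)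
    then have "y \<in> Pi\<^sub>E (carrier M) U"
      using y(1) by (auto simp: configurations_def PiE_iff)
    with U(3) show "\<tau> y m = \<tau> x m" by auto
  qed (use U(1) in auto)
qed

text \<open>
  Equivariance moves every value to the identity element: the value of \<open>\<tau> x\<close> at \<open>m\<close> is that of
  \<open>\<tau>\<close> on the configuration \<open>x\<close> shifted by \<open>m\<close>.
\<close>

lemma cellular_automata_differ_at_one:
  assumes M: "monoid M"
    and \<tau>: "\<tau> \<in> cellular_automata M A" and \<sigma>: "\<sigma> \<in> cellular_automata M A" and "\<tau> \<noteq> \<sigma>"
  obtains x where "x \<in> configurations M A" "\<tau> x \<one>\<^bsub>M\<^esub> \<noteq> \<sigma> x \<one>\<^bsub>M\<^esub>"
proof -
  interpret monoid M by (fact M)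
  have "\<tau> \<in> configurations M A \<rightarrow>\<^sub>E configurations M A" "\<sigma> \<in> configurations M A \<rightarrow>\<^sub>E configurations M A"
    using \<tau> \<sigma> by (auto simp: cellular_automata_def)
  then obtain x where x: "x \<in> configurations M A" "\<tau> x \<noteq> \<sigma> x"
      "\<tau> x \<in> configurations M A" "\<sigma> x \<in> configurations M A"
    using \<open>\<tau> \<noteq> \<sigma>\<close> by (metis PiE_ext PiE_mem)
  then obtain m where m: "m \<in> carrier M" "\<tau> x m \<noteq> \<sigma> x m"
    unfolding configurations_def by (metis PiE_ext)
  have "\<tau> (shift M m x) = shift M m (\<tau> x)" "\<sigma> (shift M m x) = shift M m (\<sigma> x)"
    using \<tau> \<sigma> x m by (auto simp: cellular_automata_def)
  then have "\<tau> (shift M m x) \<one>\<^bsub>M\<^esub> \<noteq> \<sigma> (shift M m x) \<one>\<^bsub>M\<^esub>"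
    using m by (simp add: shift_def)
  with shift_in_configurations[OF M m(1) x(1)] that show thesis by blast
qed

section \<open>Finite invariant sets of configurations\<close>

definition factoring_configurations ::
    "('m, 'b) monoid_scheme \<Rightarrow> 'a set \<Rightarrow> ('m \<Rightarrow> 'c) \<Rightarrow> ('m \<Rightarrow> 'a) set" where
  "factoring_configurations M A \<rho> =
    {x \<in> configurations M A. \<forall>m \<in> carrier M. \<forall>n \<in> carrier M. \<rho> m = \<rho> n \<longrightarrow> x m = x n}"

lemma factoring_configurationsD:
  assumes "x \<in> factoring_configurations M A \<rho>"
  shows "x \<in> configurations M A"
    and "m \<in> carrier M \<Longrightarrow> n \<in> carrier M \<Longrightarrow> \<rho> m = \<rho> n \<Longrightarrow> x m = x n"
  using assms unfolding factoring_configurations_def by blast+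

lemma finite_factoring_configurations:
  assumes "finite A" "finite (\<rho> ` carrier M)"
  shows "finite (factoring_configurations M A \<rho>)"
proof (rule finite_subset)
  show "finite ((\<lambda>z. \<lambda>m \<in> carrier M. z (\<rho> m)) ` (\<rho> ` carrier M \<rightarrow>\<^sub>E A))"
    using assms by (simp add: finite_PiE)
  show "factoring_configurations M A \<rho> \<subseteq>
      (\<lambda>z. \<lambda>m \<in> carrier M. z (\<rho> m)) ` (\<rho> ` carrier M \<rightarrow>\<^sub>E A)"
  proof
    fix x assume x: "x \<in> factoring_configurations M A \<rho>"
    then have x_PiE: "x \<in> carrier M \<rightarrow>\<^sub>E A"
      using factoring_configurationsD(1) unfolding configurations_def by blast
    define z where "z = (\<lambda>c \<in> \<rho> ` carrier M. x (inv_into (carrier M) \<rho> c))"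
    have "z \<in> \<rho> ` carrier M \<rightarrow>\<^sub>E A"
      unfolding z_def
    proof (rule restrict_PiE_iff[THEN iffD2], rule ballI)
      fix c assume "c \<in> \<rho> ` carrier M"
      then have "inv_into (carrier M) \<rho> c \<in> carrier M" by (rule inv_into_into)
      then show "x (inv_into (carrier M) \<rho> c) \<in> A"
        using x_PiE by (rule PiE_mem[rotated])
    qed
    moreover have "x = (\<lambda>m \<in> carrier M. z (\<rho> m))"
    proof
      fix m
      show "x m = (\<lambda>m \<in> carrier M. z (\<rho> m)) m"
      proof (cases "m \<in> carrier M")
        case True
        then have "inv_into (carrier M) \<rho> (\<rho> m) \<in> carrier M"
          "\<rho> (inv_into (carrier M) \<rho> (\<rho> m)) = \<rho> m"
          by (simp_all add: inv_into_into f_inv_into_f)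
        then have "x (inv_into (carrier M) \<rho> (\<rho> m)) = x m"
          using factoring_configurationsD(2)[OF x] True by blast
        then show ?thesis using True by (simp add: z_def)
      next
        case False
        then show ?thesis
          using PiE_arb[OF x_PiE False] by simp
      qed
    qed
    ultimately show "x \<in> (\<lambda>z. \<lambda>m \<in> carrier M. z (\<rho> m)) ` (\<rho> ` carrier M \<rightarrow>\<^sub>E A)"
      by (intro image_eqI[of _ _ z])
  qed
qed

text \<open>
  A condition on the shifts of \<open>x\<close> alone is inherited by the image of \<open>x\<close> under every equivariant
  map, so this reformulation makes the set invariant under cellular automata. Stability of the
  fibres of \<open>\<rho>\<close> under left multiplication enters because the value of the shift of \<open>x\<close> by \<open>m\<close> at
  \<open>k\<close> is \<open>x (k m)\<close>.
\<close>

lemma factoring_iff_shift: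
  assumes M: "monoid M"
    and \<rho>: "left_compatible M \<rho>"
  shows "x \<in> factoring_configurations M A \<rho> \<longleftrightarrow> x \<in> configurations M A \<and>
    (\<forall>m \<in> carrier M. \<forall>n \<in> carrier M. \<rho> m = \<rho> n \<longrightarrow> shift M m x = shift M n x)"
    (is "?L \<longleftrightarrow> ?R")
proof
  interpret monoid M by (fact M)
  {
    assume x: ?L
    have "shift M m x = shift M n x"
      if "m \<in> carrier M" "n \<in> carrier M" "\<rho> m = \<rho> n" for m n
    proof -
      have "x (k \<otimes>\<^bsub>M\<^esub> m) = x (k \<otimes>\<^bsub>M\<^esub> n)" if "k \<in> carrier M" for k
      proof -
        have "\<rho> (k \<otimes>\<^bsub>M\<^esub> m) = \<rho> (k \<otimes>\<^bsub>M\<^esub> n)"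
          using \<rho> that \<open>m \<in> carrier M\<close> \<open>n \<in> carrier M\<close> \<open>\<rho> m = \<rho> n\<close>
          unfolding left_compatible_def by blast
        then show ?thesis
          using x that \<open>m \<in> carrier M\<close> \<open>n \<in> carrier M\<close>
          unfolding factoring_configurations_def by blast
      qed
      then show ?thesis by (auto simp: shift_def fun_eq_iff)
    qed
    with x show ?R unfolding factoring_configurations_def by blast
  next
    assume x: ?R
    have "x m = x n" if "m \<in> carrier M" "n \<in> carrier M" "\<rho> m = \<rho> n" for m n
    proof -
      have "shift M m x = shift M n x" using x that by blast
      then have "shift M m x \<one>\<^bsub>M\<^esub> = shift M n x \<one>\<^bsub>M\<^esub>" by simp
      then show ?thesis using that by (simp add: shift_def)
    qed
    with x show ?L unfolding factoring_configurations_def by blast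
  }
qed

lemma cellular_automaton_preserves_factoring:
  assumes M: "monoid M"
    and \<rho>: "left_compatible M \<rho>"
    and \<tau>: "\<tau> \<in> cellular_automata M A" and x: "x \<in> factoring_configurations M A \<rho>"
  shows "\<tau> x \<in> factoring_configurations M A \<rho>"
proof -
  have "shift M m (\<tau> x) = shift M n (\<tau> x)"
    if mn: "m \<in> carrier M" "n \<in> carrier M" "\<rho> m = \<rho> n" for m n
  proof -
    have "x \<in> configurations M A" "shift M m x = shift M n x"
      using x mn unfolding factoring_iff_shift[OF M \<rho>] by blast+
    moreover have "shift M k (\<tau> x) = \<tau> (shift M k x)" if "k \<in> carrier M" for k
      using \<tau> that \<open>x \<in> configurations M A\<close> by (auto simp: cellular_automata_def)
    ultimately show ?thesis using mn by simp
  qed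
  moreover have "\<tau> x \<in> configurations M A"
    using \<tau> x by (auto simp: cellular_automata_def factoring_configurations_def)
  ultimately show ?thesis unfolding factoring_iff_shift[OF M \<rho>] by blast
qed

lemma factoring_configuration_interpolates:
  assumes "inj_on \<rho> S" "S \<subseteq> carrier M" and x: "x \<in> configurations M A"
  obtains y where "y \<in> factoring_configurations M A \<rho>" "\<forall>s \<in> S. y s = x s"
proof (cases "A = {}")
  case True
  \<comment> \<open>There is no map from a nonempty set to the empty set, so \<open>x\<close> itself will do.\<close>
  with x have "carrier M = {}" by (auto simp: configurations_def PiE_eq_empty_iff)
  then show thesis using that[of x] x assms(2) by (auto simp: factoring_configurations_def)
next
  case False
  then obtain a where a: "a \<in> A" by blast
  define y where
    "y = (\<lambda>m \<in> carrier M. if \<rho> m \<in> \<rho> ` S then x (inv_into S \<rho> (\<rho> m)) else a)"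
  have "x (inv_into S \<rho> (\<rho> m)) \<in> A" if "\<rho> m \<in> \<rho> ` S" for m
    using x inv_into_into[OF that] assms(2) by (auto simp: configurations_def)
  then have "y \<in> factoring_configurations M A \<rho>"
    using a by (auto simp: y_def factoring_configurations_def configurations_def)
  moreover have "\<forall>s \<in> S. y s = x s"
    using assms(1,2) by (auto simp: y_def)
  ultimately show thesis by (rule that)
qed

section \<open>Residual finiteness of the monoid of cellular automata\<close>

definition self_maps :: "'x set \<Rightarrow> ('x \<Rightarrow> 'x) monoid" where
  "self_maps X = \<lparr>carrier = X \<rightarrow>\<^sub>E X, mult = (\<lambda>f g. compose X f g), one = (\<lambda>x \<in> X. x)\<rparr>"

lemma monoid_self_maps: "monoid (self_maps X)"
proof (rule monoidI)
  fix f g h assume "f \<in> carrier (self_maps X)" "g \<in> carrier (self_maps X)"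
    "h \<in> carrier (self_maps X)"
  then have "h \<in> X \<rightarrow> X" by (simp add: self_maps_def PiE_def)
  from compose_assoc[OF this, symmetric]
  show "f \<otimes>\<^bsub>self_maps X\<^esub> g \<otimes>\<^bsub>self_maps X\<^esub> h = f \<otimes>\<^bsub>self_maps X\<^esub> (g \<otimes>\<^bsub>self_maps X\<^esub> h)"
    by (simp add: self_maps_def)
next
  fix f assume "f \<in> carrier (self_maps X)"
  then have f: "f \<in> X \<rightarrow> X" "f \<in> extensional X" by (simp_all add: self_maps_def PiE_def)
  show "\<one>\<^bsub>self_maps X\<^esub> \<otimes>\<^bsub>self_maps X\<^esub> f = f" "f \<otimes>\<^bsub>self_maps X\<^esub> \<one>\<^bsub>self_maps X\<^esub> = f"
    using Id_compose[OF f] compose_Id[OF f] by (simp_all add: self_maps_def)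
qed (auto simp: self_maps_def compose_def)

lemma restrict_hom_self_maps:
  assumes X: "X \<subseteq> configurations M A"
    and inv: "\<And>\<tau> x. \<tau> \<in> cellular_automata M A \<Longrightarrow> x \<in> X \<Longrightarrow> \<tau> x \<in> X"
  shows "(\<lambda>\<tau>. restrict \<tau> X) \<in> monoid_hom (CA M A) (self_maps X)"
proof -
  have "restrict (compose (configurations M A) \<tau> \<sigma>) X = compose X (restrict \<tau> X) (restrict \<sigma> X)"
    if "\<sigma> \<in> cellular_automata M A" for \<tau> \<sigma>
    using X inv[OF that] by (auto simp: compose_def fun_eq_iff)
  moreover have "restrict (\<lambda>x \<in> configurations M A. x) X = (\<lambda>x \<in> X. x)"
    using X by (auto simp: fun_eq_iff)
  ultimately show ?thesis
    using inv unfolding monoid_hom_def hom_def CA_def self_maps_def by auto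
qed

lemma residually_finite_CA:
  fixes M :: "('m, 'b) monoid_scheme" and A :: "'a set"
  assumes M: "monoid M" "residually_finite M" and A: "finite A"
  shows "residually_finite (CA M A)"
proof (rule residually_finiteI)
  fix \<tau> \<sigma> assume "\<tau> \<in> carrier (CA M A)" "\<sigma> \<in> carrier (CA M A)" and "\<tau> \<noteq> \<sigma>"
  then have ca: "\<tau> \<in> cellular_automata M A" "\<sigma> \<in> cellular_automata M A"
    by (auto simp: CA_def)
  then have cont: "continuous_map (prodiscrete M A) (prodiscrete M A) \<tau>"
    "continuous_map (prodiscrete M A) (prodiscrete M A) \<sigma>"
    by (auto simp: cellular_automata_def)
  let ?e = "\<one>\<^bsub>M\<^esub>"
  have e: "?e \<in> carrier M" using M(1) by (rule monoid.one_closed)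
  obtain x where x: "x \<in> configurations M A" "\<tau> x ?e \<noteq> \<sigma> x ?e"
    using cellular_automata_differ_at_one[OF M(1) ca \<open>\<tau> \<noteq> \<sigma>\<close>] .
  obtain S where S: "finite S" "S \<subseteq> carrier M"
    "\<And>y. y \<in> configurations M A \<Longrightarrow> \<forall>s \<in> S. y s = x s \<Longrightarrow> \<tau> y ?e = \<tau> x ?e"
    using prodiscrete_continuous_local[OF cont(1) x(1) e] by blast
  obtain T where T: "finite T" "T \<subseteq> carrier M"
    "\<And>y. y \<in> configurations M A \<Longrightarrow> \<forall>s \<in> T. y s = x s \<Longrightarrow> \<sigma> y ?e = \<sigma> x ?e"
    using prodiscrete_continuous_local[OF cont(2) x(1) e] by blast
  have ST: "finite (S \<union> T)" "S \<union> T \<subseteq> carrier M" using S T by auto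
  obtain \<rho> :: "'m \<Rightarrow> 'm \<times> 'm \<Rightarrow> nat" where
    \<rho>: "finite (\<rho> ` carrier M)" "inj_on \<rho> (S \<union> T)"
      "left_compatible M \<rho>"
    using residually_finite_separates_finite_set[OF M ST] .
  let ?X = "factoring_configurations M A \<rho>"
  obtain y where y: "y \<in> ?X" "\<forall>s \<in> S \<union> T. y s = x s"
    using factoring_configuration_interpolates[OF \<rho>(2) ST(2) x(1)] .
  have XC: "?X \<subseteq> configurations M A" by (auto simp: factoring_configurations_def)
  have "y \<in> configurations M A" "\<forall>s \<in> S. y s = x s" "\<forall>s \<in> T. y s = x s"
    using y XC by auto
  then have "\<tau> y ?e = \<tau> x ?e" "\<sigma> y ?e = \<sigma> x ?e"
    by (simp_all only: S(3) T(3))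
  with x(2) have "\<tau> y \<noteq> \<sigma> y" by auto
  then have "restrict \<tau> ?X \<noteq> restrict \<sigma> ?X"
    using restrict_apply'[OF y(1), of \<tau>] restrict_apply'[OF y(1), of \<sigma>] by metis
  moreover have "(\<lambda>\<tau>. restrict \<tau> ?X) \<in> monoid_hom (CA M A) (self_maps ?X)"
    using restrict_hom_self_maps[OF XC] cellular_automaton_preserves_factoring[OF M(1) \<rho>(3)]
    by blast
  moreover have "finite (carrier (self_maps ?X))"
    using finite_factoring_configurations[OF A \<rho>(1)] by (simp add: self_maps_def finite_PiE)
  ultimately show "\<exists>(F :: (('m \<Rightarrow> 'a) \<Rightarrow> ('m \<Rightarrow> 'a)) monoid) h.
      monoid F \<and> finite (carrier F) \<and> h \<in> monoid_hom (CA M A) F \<and> h \<tau> \<noteq> h \<sigma>"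
    using monoid_self_maps[of ?X]
    by (intro exI[of _ "self_maps ?X"] exI[of _ "\<lambda>\<tau>. restrict \<tau> ?X"] conjI)
qed

theorem theorem1p1:
  fixes M :: "('m, 'b) monoid_scheme" and A :: "'a set"
  assumes "monoid M" and "finite A" and "card A > 1"
  shows "residually_finite M \<longleftrightarrow> residually_finite (CA M A)"
proof
  assume "residually_finite M"
  then show "residually_finite (CA M A)"
    using residually_finite_CA assms(1,2) by blast
next
  assume CA: "residually_finite (CA M A)"
  obtain a b where "a \<in> A" "b \<in> A" "a \<noteq> b"
    using assms(2,3) by (metis One_nat_def card_le_Suc0_iff_eq not_less)
  then have "inj_on (translation M A) (carrier (opposite M))"
    using inj_on_translation[OF assms(1)] by (simp add: opposite_def)
  from residually_finite_of_inj_hom[OF translation_hom[OF assms(1)] this CA]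
  show "residually_finite M" by (rule residually_finite_of_opposite)
qed

end
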